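(* Let $K$ be a field, $n>1$, $A=K[x_1,\dots,x_n]$, and let $k\ge1$, $d\ge k$ be integers. Let $I_k$ be the set of $1$-dimensional subspaces of $A_k$ spanned by homogeneous polynomials of degree $k$ that are powers of irreducible polynomials, and let $\mathcal D=\{A_{d-k}y\mid \langle y\rangle\in I_k\}$. Let $c$ be the positive integer with $0\le d-kc<k$. Then $\mathcal D$ is a generalized dual arc with vector dimensions $(\dim A_d,\dim A_{d-k},\dots,\dim A_{d-ck})$: each member has dimension $\dim A_{d-k}$, the intersection of any $m$ distinct members ($2\le m\le c$) has dimension $\dim A_{d-mk}$, and the intersection of any $c+1$ distinct members is $0$.
   Context: $A_m$ is the space of homogeneous polynomials of degree $m$ in $A$; $A_{d-k}y=\{gy\mid g\in A_{d-k}\}$. A generalized dual arc with vector dimensions $(N,n_1,\dots,n_c)$ is a set of $n_1$-dimensional subspaces of an $N$-dimensional space such that the intersection of any $j$ distinct members has dimension $n_j>0$ for $j=2,\dots,c$ and the intersection of any $c+1$ distinct members is $0$. *)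

theory Defs
  imports
    Complex_Main
    "HOL-Library.Cardinality"
    "HOL-Library.Poly_Mapping"
    "HOL-Computational_Algebra.Factorial_Ring"
begin

text \<open>
  The polynomial ring over \<open>'k\<close> with one variable for each element of \<open>'v\<close>, as finitely
  supported functions from exponent vectors to coefficients, with the convolution product.
\<close>

type_synonym ('v, 'k) mpoly = "('v \<Rightarrow>\<^sub>0 nat) \<Rightarrow>\<^sub>0 'k"

definition mscale :: "'k::field \<Rightarrow> ('v, 'k) mpoly \<Rightarrow> ('v, 'k) mpoly"
  where "mscale a p = Poly_Mapping.single 0 a * p"

lemma lookup_mscale: "Poly_Mapping.lookup (mscale a p) m = a * Poly_Mapping.lookup p m"
  unfolding mscale_def mult_map_scale_conv_mult[symmetric]
  by transfer (simp add: when_def)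

interpretation mpoly: vector_space "mscale :: 'k::field \<Rightarrow> ('v, 'k) mpoly \<Rightarrow> ('v, 'k) mpoly"
proof
  show "mscale 1 x = x" for x :: "('v, 'k) mpoly"
    by (simp add: mscale_def)
qed (simp_all add: mscale_def distrib_left distrib_right single_add mult_single flip: mult.assoc)

text \<open>The space \<open>A\<^sub>m\<close>, which contains the zero polynomial.\<close>

definition homogeneous_polys :: "nat \<Rightarrow> ('v::finite, 'k::field) mpoly set"
  where "homogeneous_polys m =
    {p. \<forall>t\<in>Poly_Mapping.keys p. (\<Sum>i\<in>UNIV. Poly_Mapping.lookup t i) = m}"

definition irreducible_power_lines :: "nat \<Rightarrow> ('v::finite, 'k::field) mpoly set set"
  where "irreducible_power_lines k =
    {mpoly.span {y} | y. y \<in> homogeneous_polys k \<and> (\<exists>f e. irreducible f \<and> y = f ^ e)}"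

definition multiples_space :: "nat \<Rightarrow> ('v::finite, 'k::field) mpoly \<Rightarrow> ('v, 'k) mpoly set"
  where "multiples_space m y = {g * y | g. g \<in> homogeneous_polys m}"

definition irreducible_power_family :: "nat \<Rightarrow> nat \<Rightarrow> ('v::finite, 'k::field) mpoly set set"
  where "irreducible_power_family d k =
    {multiples_space (d - k) y | y. mpoly.span {y} \<in> irreducible_power_lines k}"

context vector_space
begin

text \<open>The library's \<^term>\<open>dim\<close> is 0 on spaces of infinite dimension, so
  finite dimensionality is stated separately.\<close>

definition subspace_of_dim :: "'b set \<Rightarrow> nat \<Rightarrow> bool"
  where "subspace_of_dim W r \<longleftrightarrow>
    subspace W \<and> (\<exists>B. finite B \<and> W \<subseteq> span B) \<and> dim W = r"

text \<open>
  The vector dimensions \<open>(N, n\<^sub>1, \<dots>, n\<^sub>c)\<close> are given by \<open>N\<close>, \<open>c\<close> and the function \<open>n\<close>, whose values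
  outside \<open>{1..c}\<close> are irrelevant. \<open>V\<close> is the ambient \<open>N\<close>-dimensional space.
\<close>

definition generalized_dual_arc :: "'b set \<Rightarrow> nat \<Rightarrow> nat \<Rightarrow> (nat \<Rightarrow> nat) \<Rightarrow> 'b set set \<Rightarrow> bool"
  where "generalized_dual_arc V N c n D \<longleftrightarrow>
    local.subspace_of_dim V N \<and>
    (\<forall>W\<in>D. W \<subseteq> V \<and> local.subspace_of_dim W (n 1)) \<and>
    (\<forall>j\<in>{2..c}. n j > 0) \<and>
    (\<forall>j\<in>{2..c}. \<forall>S. S \<subseteq> D \<and> card S = j \<longrightarrow> local.subspace_of_dim (\<Inter>S) (n j)) \<and>
    (\<forall>S. S \<subseteq> D \<and> card S = c + 1 \<longrightarrow> \<Inter>S = {0})"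

end

end

theory Submission
  imports Defs "HOL-Computational_Algebra.Polynomial"
begin

text \<open>
  By unique factorization, an irreducible polynomial is prime. Let \<open>f\<^sup>a\<close> and \<open>g\<^sup>b\<close> be powers of
  irreducible polynomials that are homogeneous of the same degree \<open>k\<close>. If \<open>f\<close> divides \<open>g\<close>, then the
  powers differ by a factor of degree \<open>0\<close> and define the same member of the family; otherwise they
  are coprime. A polynomial that lies in \<open>m\<close> distinct members is therefore a multiple of the product
  of \<open>m\<close> generators, which is homogeneous of degree \<open>m k\<close>. So the intersection is the image of
  \<open>A\<^bsub>d-mk\<^esub>\<close> under an injective multiplication map if \<open>m k \<le> d\<close>, and it is \<open>0\<close> if \<open>m k > d\<close>.

  Primality of irreducibles is proved by induction on the set of variables. The step replaces Gauss's
  lemma by a descent: if \<open>f\<close> divides \<open>g h\<close>, pseudo-division by an element \<open>u\<close> of least degree in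
  the new variable with \<open>f dvd u h\<close> shows that \<open>u\<close> divides \<open>f\<close> and \<open>g\<close> up to factors without the new
  variable, and these factors can be cancelled.
\<close>

subsection \<open>Ring homomorphisms on monoid algebras\<close>

text \<open>The universal property of the monoid algebra. Weight components, splitting off a
  variable and renaming are instances; each gets its ring laws from the locale below.\<close>

definition monoid_algebra_extend ::
    "('k::comm_ring_1 \<Rightarrow> 'r::comm_ring_1) \<Rightarrow> ('m::comm_monoid_add \<Rightarrow> 'r) \<Rightarrow> ('m \<Rightarrow>\<^sub>0 'k) \<Rightarrow> 'r"
  where "monoid_algebra_extend c f p =
    (\<Sum>t\<in>Poly_Mapping.keys p. c (Poly_Mapping.lookup p t) * f t)"

lemma poly_mapping_eq_sum_single:
  "p = (\<Sum>t\<in>Poly_Mapping.keys p. Poly_Mapping.single t (Poly_Mapping.lookup p t))"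
  by (rule poly_mapping_eqI)
     (simp add: lookup_sum lookup_single when_def in_keys_iff)

locale monoid_algebra_hom =
  fixes c :: "'k::comm_ring_1 \<Rightarrow> 'r::comm_ring_1" and f :: "'m::comm_monoid_add \<Rightarrow> 'r"
  assumes coeff_0 [simp]: "c 0 = 0" and coeff_1 [simp]: "c 1 = 1"
    and coeff_add: "c (a + b) = c a + c b" and coeff_mult: "c (a * b) = c a * c b"
    and monom_0 [simp]: "f 0 = 1" and monom_add: "f (s + t) = f s * f t"
begin

abbreviation "hom \<equiv> monoid_algebra_extend c f"

lemma hom_eq_sum_superset:
  assumes "finite T" "Poly_Mapping.keys p \<subseteq> T"
  shows "hom p = (\<Sum>t\<in>T. c (Poly_Mapping.lookup p t) * f t)"
  unfolding monoid_algebra_extend_def using assms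
  by (intro sum.mono_neutral_left) (auto simp: in_keys_iff)

lemma hom_0 [simp]: "hom 0 = 0"
  by (simp add: monoid_algebra_extend_def)

lemma hom_single [simp]: "hom (Poly_Mapping.single t a) = c a * f t"
  by (simp add: monoid_algebra_extend_def)

lemma hom_1 [simp]: "hom 1 = 1"
  using hom_single[of 0 1] by (simp del: hom_single)

lemma hom_add: "hom (p + q) = hom p + hom q"
proof -
  let ?T = "Poly_Mapping.keys p \<union> Poly_Mapping.keys q"
  have "hom p = (\<Sum>t\<in>?T. c (Poly_Mapping.lookup p t) * f t)"
    "hom q = (\<Sum>t\<in>?T. c (Poly_Mapping.lookup q t) * f t)"
    "hom (p + q) = (\<Sum>t\<in>?T. c (Poly_Mapping.lookup (p + q) t) * f t)"
    by (rule hom_eq_sum_superset; use Poly_Mapping.keys_add[of p q] in auto)+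
  then show ?thesis
    by (simp add: lookup_add coeff_add distrib_right sum.distrib)
qed

lemma hom_sum: "hom (sum g T) = (\<Sum>t\<in>T. hom (g t))"
  by (induction T rule: infinite_finite_induct) (simp_all add: hom_add)

lemma hom_diff: "hom (p - q) = hom p - hom q"
  using hom_add[of "p - q" q] by (simp add: algebra_simps)

lemma hom_mult: "hom (p * q) = hom p * hom q"
proof -
  let ?p = "\<lambda>t. Poly_Mapping.single t (Poly_Mapping.lookup p t)"
  let ?q = "\<lambda>t. Poly_Mapping.single t (Poly_Mapping.lookup q t)"
  have "p * q = (\<Sum>s\<in>Poly_Mapping.keys p. \<Sum>t\<in>Poly_Mapping.keys q. ?p s * ?q t)"
    by (subst poly_mapping_eq_sum_single[of p], subst poly_mapping_eq_sum_single[of q])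
       (rule sum_product)
  then have "hom (p * q) = (\<Sum>s\<in>Poly_Mapping.keys p. \<Sum>t\<in>Poly_Mapping.keys q. hom (?p s) * hom (?q t))"
    by (simp add: hom_sum mult_single coeff_mult monom_add mult_ac)
  also have "\<dots> = hom p * hom q"
    unfolding hom_single by (simp add: monoid_algebra_extend_def sum_product)
  finally show ?thesis .
qed

end

subsection \<open>Weights\<close>

text \<open>Summing over the support keeps the weight meaningful for infinite \<open>S\<close>, such
  as a complement in an infinite type of variables.\<close>

definition weight :: "'v set \<Rightarrow> ('v \<Rightarrow>\<^sub>0 nat) \<Rightarrow> nat"
  where "weight S t = (\<Sum>i\<in>Poly_Mapping.keys t \<inter> S. Poly_Mapping.lookup t i)"

lemma weight_eq_sum_superset:
  assumes "finite T" "Poly_Mapping.keys t \<inter> S \<subseteq> T" "T \<subseteq> S"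
  shows "weight S t = (\<Sum>i\<in>T. Poly_Mapping.lookup t i)"
  unfolding weight_def using assms by (intro sum.mono_neutral_left) (auto simp: in_keys_iff)

lemma weight_0 [simp]: "weight S 0 = 0"
  by (simp add: weight_def)

lemma weight_add: "weight S (s + t) = weight S s + weight S t"
proof -
  let ?T = "(Poly_Mapping.keys s \<union> Poly_Mapping.keys t) \<inter> S"
  have "weight S s = (\<Sum>i\<in>?T. Poly_Mapping.lookup s i)"
    "weight S t = (\<Sum>i\<in>?T. Poly_Mapping.lookup t i)"
    "weight S (s + t) = (\<Sum>i\<in>?T. Poly_Mapping.lookup (s + t) i)"
    by (rule weight_eq_sum_superset; use Poly_Mapping.keys_add[of s t] in auto)+
  then show ?thesis
    by (simp add: lookup_add sum.distrib)
qed

lemma weight_eq_0_iff: "weight S t = 0 \<longleftrightarrow> Poly_Mapping.keys t \<inter> S = {}"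
  by (auto simp: weight_def in_keys_iff)

lemma weight_UNIV: "weight UNIV (t :: 'v::finite \<Rightarrow>\<^sub>0 nat) = (\<Sum>i\<in>UNIV. Poly_Mapping.lookup t i)"
  by (rule weight_eq_sum_superset) auto

text \<open>
  The homomorphism \<open>x\<^sup>t \<mapsto> x\<^sup>t X\<^bsup>w(t)\<^esup>\<close> into the univariate polynomials: its coefficients
  are the homogeneous components with respect to the weight \<open>w\<close>.
\<close>

definition weight_poly :: "'v set \<Rightarrow> ('v, 'k::field) mpoly \<Rightarrow> ('v, 'k) mpoly poly"
  where "weight_poly S = monoid_algebra_extend (\<lambda>a. [:Poly_Mapping.single 0 a:])
    (\<lambda>t. monom (Poly_Mapping.single t 1) (weight S t))"

interpretation weight_poly: monoid_algebra_hom
    "\<lambda>a::'k::field. [:Poly_Mapping.single 0 a :: ('v, 'k) mpoly:]"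
    "\<lambda>t. monom (Poly_Mapping.single t 1) (weight S t)"
  rewrites "monoid_algebra_extend (\<lambda>a. [:Poly_Mapping.single 0 a:])
    (\<lambda>t. monom (Poly_Mapping.single t 1) (weight S t)) = weight_poly S"
  for S :: "'v set"
proof unfold_locales
  show "[:Poly_Mapping.single 0 (a * b) :: ('v, 'k) mpoly:] = [:Poly_Mapping.single 0 a:] * [:Poly_Mapping.single 0 b:]"
    for a b :: 'k
    by (simp add: mult_single mult.commute[of b a])
qed (simp_all add: single_add mult_single weight_add mult_monom monom_0 weight_poly_def flip: one_pCons)

lemma lookup_coeff_weight_poly:
  "Poly_Mapping.lookup (coeff (weight_poly S p) j) t =
    (if weight S t = j then Poly_Mapping.lookup p t else 0)"
proof -
  have *: "coeff (weight_poly S p) j = (\<Sum>s\<in>Poly_Mapping.keys p.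
      if weight S s = j then Poly_Mapping.single s (Poly_Mapping.lookup p s) else 0)"
    unfolding weight_poly_def monoid_algebra_extend_def coeff_sum
    by (intro sum.cong) (simp_all add: mult_single)
  have "Poly_Mapping.lookup (coeff (weight_poly S p) j) t = (\<Sum>s\<in>Poly_Mapping.keys p.
      if s = t then if weight S t = j then Poly_Mapping.lookup p t else 0 else 0)"
    unfolding * lookup_sum by (intro sum.cong) (simp_all add: lookup_single when_def)
  then show ?thesis
    by (simp add: in_keys_iff)
qed

lemma poly_weight_poly_1 [simp]: "poly (weight_poly S p) 1 = p"
  by (subst (2) poly_mapping_eq_sum_single[of p])
     (simp add: weight_poly_def monoid_algebra_extend_def poly_sum poly_monom mult_single)

text \<open>Homogeneity becomes an equation in a univariate polynomial ring, so closure properties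
  follow from the homomorphism laws.\<close>

lemma weight_poly_eq_monom_iff:
  "weight_poly S p = monom p k \<longleftrightarrow> (\<forall>t\<in>Poly_Mapping.keys p. weight S t = k)"
  by (auto simp: poly_eq_iff poly_mapping_eq_iff fun_eq_iff lookup_coeff_weight_poly in_keys_iff)

lemma homogeneous_polys_iff_weight_poly:
  "p \<in> homogeneous_polys k \<longleftrightarrow> weight_poly UNIV p = monom p k"
  by (simp add: homogeneous_polys_def weight_poly_eq_monom_iff weight_UNIV)

subsection \<open>Polynomials in a set of variables\<close>

definition polys_in :: "'v set \<Rightarrow> ('v, 'k::field) mpoly set"
  where "polys_in S = {p. \<forall>t\<in>Poly_Mapping.keys p. Poly_Mapping.keys t \<subseteq> S}"

lemma polys_in_iff_weight_poly: "p \<in> polys_in S \<longleftrightarrow> weight_poly (- S) p = monom p 0"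
  by (auto simp: polys_in_def weight_poly_eq_monom_iff weight_eq_0_iff)

lemma polys_in_iff_degree: "p \<in> polys_in S \<longleftrightarrow> degree (weight_poly (- S) p) = 0"
proof
  assume "degree (weight_poly (- S) p) = 0"
  then obtain c where c: "weight_poly (- S) p = [:c:]"
    by (elim degree_eq_zeroE)
  \<comment> \<open>Evaluation at \<open>1\<close> identifies the constant with \<open>p\<close>
    itself.\<close>
  with poly_weight_poly_1[of "- S" p] show "p \<in> polys_in S"
    by (simp add: polys_in_iff_weight_poly monom_0)
qed (simp add: polys_in_iff_weight_poly degree_monom_eq monom_0)

lemma polys_in_0 [simp]: "0 \<in> polys_in S"
  by (simp add: polys_in_def)

lemma polys_in_single [simp]: "Poly_Mapping.keys t \<subseteq> S \<Longrightarrow> Poly_Mapping.single t a \<in> polys_in S"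
  by (simp add: polys_in_def)

lemma polys_in_add: "p \<in> polys_in S \<Longrightarrow> q \<in> polys_in S \<Longrightarrow> p + q \<in> polys_in S"
  by (simp add: polys_in_iff_weight_poly weight_poly.hom_add add_monom)

lemma polys_in_diff: "p \<in> polys_in S \<Longrightarrow> q \<in> polys_in S \<Longrightarrow> p - q \<in> polys_in S"
  by (simp add: polys_in_iff_weight_poly weight_poly.hom_diff diff_monom)

lemma polys_in_mult: "p \<in> polys_in S \<Longrightarrow> q \<in> polys_in S \<Longrightarrow> p * q \<in> polys_in S"
  by (simp add: polys_in_iff_weight_poly weight_poly.hom_mult mult_monom)

lemma polys_in_sum: "(\<And>i. i \<in> I \<Longrightarrow> f i \<in> polys_in S) \<Longrightarrow> sum f I \<in> polys_in S"
  by (induction I rule: infinite_finite_induct) (simp_all add: polys_in_add)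

lemma polys_in_mono: "S \<subseteq> T \<Longrightarrow> polys_in S \<subseteq> polys_in T"
  by (auto simp: polys_in_def)

lemma polys_in_emptyD:
  assumes "p \<in> polys_in {}"
  shows "p = Poly_Mapping.single 0 (Poly_Mapping.lookup p 0)"
proof (rule poly_mapping_eqI)
  fix t
  show "Poly_Mapping.lookup p t = Poly_Mapping.lookup (Poly_Mapping.single 0 (Poly_Mapping.lookup p 0)) t"
    using assms by (cases "t = 0") (auto simp: polys_in_def lookup_single in_keys_iff)
qed

lemma single_0_dvd_1:
  assumes "(a :: 'k::field) \<noteq> 0"
  shows "(Poly_Mapping.single 0 a :: ('v, 'k) mpoly) dvd 1"
  by (rule dvdI[of _ _ "Poly_Mapping.single 0 (inverse a)"]) (simp add: mult_single assms)

lemma polys_in_empty_dvd_1: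
  assumes "p \<in> polys_in {}" "p \<noteq> 0"
  shows "p dvd 1"
  using polys_in_emptyD[OF assms(1)] single_0_dvd_1 assms(2) by (metis single_zero)

text \<open>In a domain the degree in the variables outside \<open>S\<close> is additive, so it
  vanishes for both factors. The order on the variables supplies the domain.\<close>

lemma polys_in_multD:
  fixes p :: "('v::linorder, 'k::field) mpoly"
  assumes "p * q \<in> polys_in S" "p * q \<noteq> 0"
  shows "p \<in> polys_in S"
proof -
  have "weight_poly (- S) p \<noteq> 0" "weight_poly (- S) q \<noteq> 0"
    using assms(2) by (metis mult_zero_left mult_zero_right poly_0 poly_weight_poly_1)+
  then show ?thesis
    using assms(1) by (simp add: polys_in_iff_degree weight_poly.hom_mult degree_mult_eq)
qed

subsection \<open>Splitting off a variable\<close>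

text \<open>The coefficients stay in the full polynomial type although they no longer involve
  \<open>x\<close>; evaluation at \<open>var x\<close> recovers the polynomial.\<close>

definition split_var :: "'v \<Rightarrow> ('v, 'k::field) mpoly \<Rightarrow> ('v, 'k) mpoly poly"
  where "split_var x = monoid_algebra_extend (\<lambda>a. [:Poly_Mapping.single 0 a:])
    (\<lambda>t. monom (Poly_Mapping.single (Poly_Mapping.update x 0 t) 1) (Poly_Mapping.lookup t x))"

lemma update_0_add:
  "Poly_Mapping.update x 0 (s + t) = Poly_Mapping.update x 0 s + Poly_Mapping.update x (0::nat) t"
  by (rule poly_mapping_eqI) (simp add: lookup_update lookup_add)

lemma update_0_0: "Poly_Mapping.update x 0 0 = 0"
  by (rule poly_mapping_eqI) (simp add: lookup_update)

lemma update_0_plus_single: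
  "Poly_Mapping.update x 0 t + Poly_Mapping.single x (Poly_Mapping.lookup t x) = (t :: _ \<Rightarrow>\<^sub>0 nat)"
  by (rule poly_mapping_eqI) (simp add: lookup_update lookup_add lookup_single when_def)

interpretation split_var: monoid_algebra_hom
    "\<lambda>a::'k::field. [:Poly_Mapping.single 0 a :: ('v, 'k) mpoly:]"
    "\<lambda>t. monom (Poly_Mapping.single (Poly_Mapping.update x 0 t) 1) (Poly_Mapping.lookup t x)"
  rewrites "monoid_algebra_extend (\<lambda>a. [:Poly_Mapping.single 0 a:])
    (\<lambda>t. monom (Poly_Mapping.single (Poly_Mapping.update x 0 t) 1) (Poly_Mapping.lookup t x))
      = split_var x"
  for x :: 'v
proof unfold_locales
  show "[:Poly_Mapping.single 0 (a * b) :: ('v, 'k) mpoly:] = [:Poly_Mapping.single 0 a:] * [:Poly_Mapping.single 0 b:]"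
    for a b :: 'k
    by (simp add: mult_single mult.commute[of b a])
qed (simp_all add: single_add mult_single update_0_add update_0_0 lookup_add mult_monom monom_0
      split_var_def flip: one_pCons)

definition var :: "'v \<Rightarrow> ('v, 'k::field) mpoly"
  where "var x = Poly_Mapping.single (Poly_Mapping.single x 1) 1"

lemma var_power: "var x ^ n = Poly_Mapping.single (Poly_Mapping.single x n) 1"
  by (induction n) (simp_all add: var_def mult_single flip: single_add)

lemma split_var_var: "split_var x (var x) = [:0, 1:]"
proof -
  have "Poly_Mapping.update x 0 (Poly_Mapping.single x 1) = (0 :: _ \<Rightarrow>\<^sub>0 nat)"
    by (rule poly_mapping_eqI) (simp add: lookup_update lookup_single when_def)
  then show ?thesis
    by (simp add: var_def monom_Suc monom_0 flip: one_pCons)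
qed

lemma poly_split_var_var [simp]: "poly (split_var x p) (var x) = p"
  by (subst (2) poly_mapping_eq_sum_single[of p])
     (simp add: split_var_def monoid_algebra_extend_def poly_sum poly_monom mult_single var_power
       update_0_plus_single)

lemma split_var_const:
  assumes "p \<in> polys_in S" "x \<notin> S"
  shows "split_var x p = [:p:]"
proof -
  have *: "Poly_Mapping.lookup t x = 0" if "t \<in> Poly_Mapping.keys p" for t
    using assms that by (auto simp: polys_in_def not_in_keys_iff_lookup_eq_zero[symmetric])
  have **: "Poly_Mapping.update x 0 t = t" if "t \<in> Poly_Mapping.keys p" for t
    using *[OF that] by (intro poly_mapping_eqI) (auto simp: lookup_update)
  have "split_var x p = (\<Sum>t\<in>Poly_Mapping.keys p. [:Poly_Mapping.single t (Poly_Mapping.lookup p t):])"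
    unfolding split_var_def monoid_algebra_extend_def
    by (intro sum.cong) (simp_all add: * ** mult_single monom_0)
  also have "\<dots> = [:\<Sum>t\<in>Poly_Mapping.keys p. Poly_Mapping.single t (Poly_Mapping.lookup p t):]"
    by (rule poly_eqI) (simp add: coeff_sum coeff_pCons split: nat.split)
  also have "\<dots> = [:p:]"
    by (simp flip: poly_mapping_eq_sum_single)
  finally show ?thesis .
qed

lemma coeff_split_var_in:
  assumes "p \<in> polys_in (insert x S)"
  shows "coeff (split_var x p) j \<in> polys_in S"
  unfolding split_var_def monoid_algebra_extend_def coeff_sum
proof (rule polys_in_sum)
  fix t assume "t \<in> Poly_Mapping.keys p"
  with assms have "Poly_Mapping.keys (Poly_Mapping.update x 0 t) \<subseteq> S"
    by (auto simp: polys_in_def keys_update)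
  then show "coeff ([:Poly_Mapping.single 0 (Poly_Mapping.lookup p t):] *
      monom (Poly_Mapping.single (Poly_Mapping.update x 0 t) 1) (Poly_Mapping.lookup t x)) j \<in> polys_in S"
    by (simp add: mult_single)
qed

lemma degree_less_if_coeff_eq_0:
  assumes "degree q \<le> n" "coeff q n = 0"
  shows "q = 0 \<or> degree q < n"
  using assms by (metis le_neq_implies_less leading_coeff_0_iff)

lemma dvd_if_dvd_unit_mult:
  fixes a f h :: "'a::comm_semiring_1"
  assumes "a dvd 1" "f dvd a * h"
  shows "f dvd h"
proof -
  obtain b where "1 = a * b"
    using assms(1) by auto
  then have "h = b * (a * h)"
    by (metis mult.assoc mult.commute mult.left_neutral)
  then show ?thesis
    using assms(2) by (metis dvd_mult)
qed

subsection \<open>Adjoining a variable to a factorial ring\<close>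

text \<open>
  \<open>C'\<close> plays the role of \<open>C[x]\<close>, both inside one ambient domain, and \<open>split\<close> reads an element of
  \<open>C'\<close> as a polynomial in \<open>x\<close>. Since \<open>C\<close> and \<open>C'\<close> are closed under divisors, divisibility and
  irreducibility in them agree with the ambient notions. The additive \<open>size\<close> makes divisibility
  well-founded.
\<close>

locale adjoined_variable =
  fixes C C' :: "'a::idom set" and split :: "'a \<Rightarrow> 'a poly" and x :: 'a and size :: "'a \<Rightarrow> nat"
  assumes C_subset: "C \<subseteq> C'" and x_in: "x \<in> C'"
    and C'_diff: "\<And>p q. p \<in> C' \<Longrightarrow> q \<in> C' \<Longrightarrow> p - q \<in> C'"
    and C'_mult: "\<And>p q. p \<in> C' \<Longrightarrow> q \<in> C' \<Longrightarrow> p * q \<in> C'"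
    and C_multD: "\<And>p q. p * q \<in> C \<Longrightarrow> p * q \<noteq> 0 \<Longrightarrow> p \<in> C"
    and C'_multD: "\<And>p q. p * q \<in> C' \<Longrightarrow> p * q \<noteq> 0 \<Longrightarrow> p \<in> C'"
    and zero_in: "0 \<in> C" and one_in: "1 \<in> C"
    and split_diff: "\<And>p q. split (p - q) = split p - split q"
    and split_mult: "\<And>p q. split (p * q) = split p * split q"
    and poly_split: "\<And>p. poly (split p) x = p"
    and split_const: "\<And>c. c \<in> C \<Longrightarrow> split c = [:c:]"
    and split_x: "split x = [:0, 1:]"
    and coeff_split: "\<And>p j. p \<in> C' \<Longrightarrow> coeff (split p) j \<in> C"
    and size_mult: "\<And>p q. p \<noteq> 0 \<Longrightarrow> q \<noteq> 0 \<Longrightarrow> size (p * q) = size p + size q"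
    and size_eq_0D: "\<And>p. p \<noteq> 0 \<Longrightarrow> size p = 0 \<Longrightarrow> p dvd 1"
    and C_prime: "\<And>p q r. p \<in> C \<Longrightarrow> q \<in> C \<Longrightarrow> r \<in> C \<Longrightarrow> irreducible p \<Longrightarrow> p dvd q * r \<Longrightarrow> p dvd q \<or> p dvd r"
begin

lemma C'_add: "p \<in> C' \<Longrightarrow> q \<in> C' \<Longrightarrow> p + q \<in> C'"
  using C'_diff[of p "0 - q"] C'_diff[of 0 q] zero_in C_subset by auto

lemma split_0 [simp]: "split 0 = 0"
  using split_const[OF zero_in] by simp

lemma split_eq_0_iff [simp]: "split p = 0 \<longleftrightarrow> p = 0"
  using poly_split[of p] by auto

lemma degree_split_mult: "p \<noteq> 0 \<Longrightarrow> q \<noteq> 0 \<Longrightarrow> degree (split (p * q)) = degree (split p) + degree (split q)"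
  by (simp add: split_mult degree_mult_eq)

lemma degree_split_const: "c \<in> C \<Longrightarrow> degree (split c) = 0"
  by (simp add: split_const)

lemma in_C_if_degree_split: "p \<in> C' \<Longrightarrow> degree (split p) = 0 \<Longrightarrow> p \<in> C"
  using poly_split[of p] coeff_split[of p 0] by (metis degree_eq_zeroE coeff_pCons_0 mult_zero_right poly_pCons poly_0 add_0_right)

lemma lead_coeff_split:
  "p \<in> C' \<Longrightarrow> lead_coeff (split p) \<in> C"
  by (rule coeff_split)

lemma x_power_in: "x ^ n \<in> C'"
  by (induction n) (use one_in C_subset x_in C'_mult in auto)

lemma split_monom: "c \<in> C \<Longrightarrow> split (c * x ^ n) = monom c n"
proof (induction n arbitrary: c)
  case 0
  then show ?case by (simp add: split_const monom_0)
next
  case (Suc n)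
  have "split (c * x ^ Suc n) = split x * split (c * x ^ n)"
    by (simp flip: split_mult add: mult_ac)
  then show ?case
    using Suc by (simp add: split_x monom_Suc)
qed

section \<open>Factorization into irreducibles\<close>

lemma exists_irreducible_divisor:
  fixes a :: 'a
  assumes "a \<noteq> 0" "\<not> a dvd 1"
  obtains p where "irreducible p" "p dvd a"
  using assms
proof (induction "size a" arbitrary: a thesis rule: less_induct)
  case less
  show ?case
  proof (cases "irreducible a")
    case False
    then obtain b c where bc: "a = b * c" "\<not> b dvd 1" "\<not> c dvd 1"
      using less.prems by (auto simp: irreducible_def)
    then have "b \<noteq> 0" "c \<noteq> 0"
      using less.prems by auto
    then have "size b < size a"
      using bc size_mult[of b c] size_eq_0D[of c] by auto
    from less.hyps[OF this _ \<open>b \<noteq> 0\<close> bc(2)] obtain p where "irreducible p" "p dvd b"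
      by blast
    with less.prems(1) bc(1) show ?thesis by auto
  qed (use less.prems(1) in auto)
qed

text \<open>Nonzero nonunits have positive \<open>size\<close>, so splitting off an irreducible
  divisor leaves a smaller cofactor; closure under divisors keeps both factors in
  \<open>C\<close>.\<close>

lemma factor_induct [consumes 2, case_names unit step]:
  fixes a :: 'a
  assumes "a \<in> C" "a \<noteq> 0"
    and "\<And>a. a dvd 1 \<Longrightarrow> P a"
    and "\<And>p a. irreducible p \<Longrightarrow> p \<in> C \<Longrightarrow> a \<in> C \<Longrightarrow> a \<noteq> 0 \<Longrightarrow> P a \<Longrightarrow> P (p * a)"
  shows "P a"
  using assms(1,2)
proof (induction "size a" arbitrary: a rule: less_induct)
  case less
  show ?case
  proof (cases "a dvd 1")
    case False
    then obtain p where p: "irreducible p" "p dvd a"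
      using less.prems exists_irreducible_divisor by metis
    then obtain b where b: "a = p * b" by auto
    then have in_C: "p \<in> C" "b \<in> C" "b \<noteq> 0" "p \<noteq> 0"
      using less.prems C_multD[of p b] C_multD[of b p] by (auto simp: mult.commute)
    moreover have "size p \<noteq> 0"
      using p size_eq_0D \<open>p \<noteq> 0\<close> by (auto simp: irreducible_def)
    ultimately have "size b < size a"
      using b size_mult[of p b] by simp
    with less.hyps b in_C p assms(4) show ?thesis by blast
  qed (use assms(3) in auto)
qed

text \<open>As a constant in \<open>x\<close>, \<open>p\<close> divides the product of the two
  leading coefficients, hence one of them. Subtracting that leading term, a multiple of
  \<open>p\<close>, lowers the degree.\<close>

lemma C_prime_adjoined:
  assumes "p \<in> C" "irreducible p" "q \<in> C'" "r \<in> C'" "p dvd q * r"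
  shows "p dvd q \<or> p dvd r"
  using assms(3-5)
proof (induction "degree (split q) + degree (split r)" arbitrary: q r rule: less_induct)
  case less
  \<comment> \<open>The alternative \<open>= 0\<close> covers constants, whose degree cannot
    drop.\<close>
  have lower: "lead_coeff (split q) * x ^ degree (split q) \<in> C'"
    "q - lead_coeff (split q) * x ^ degree (split q) = 0 \<or>
     degree (split (q - lead_coeff (split q) * x ^ degree (split q))) < degree (split q)"
    if "q \<in> C'" for q
  proof -
    have c: "lead_coeff (split q) \<in> C"
      using that by (rule coeff_split)
    then show "lead_coeff (split q) * x ^ degree (split q) \<in> C'"
      using C_subset x_power_in C'_mult by blast
    have eq: "split (q - lead_coeff (split q) * x ^ degree (split q)) =
        split q - monom (lead_coeff (split q)) (degree (split q))"
      by (simp add: split_diff split_monom[OF c])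
    show "q - lead_coeff (split q) * x ^ degree (split q) = 0 \<or>
     degree (split (q - lead_coeff (split q) * x ^ degree (split q))) < degree (split q)"
      unfolding split_eq_0_iff[symmetric]
      by (rule degree_less_if_coeff_eq_0) (simp_all only: eq, simp_all add: degree_diff_le degree_monom_le)
  qed
  show ?case
  proof (cases "q = 0 \<or> r = 0")
    case False
    let ?a = "lead_coeff (split q)" and ?b = "lead_coeff (split r)"
    obtain w where "q * r = p * w"
      using less.prems by auto
    then have "split q * split r = smult p (split w)"
      using split_mult[of q r] split_mult[of p w] split_const[OF assms(1)] by simp
    then have "p dvd ?a * ?b"
      by (metis lead_coeff_mult lead_coeff_smult dvd_triv_left)
    then consider "p dvd ?a" | "p dvd ?b"
      using C_prime assms(1,2) less.prems lead_coeff_split by blast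
    then show ?thesis
    proof cases
      case 1
      let ?q = "?a * x ^ degree (split q)"
      have "p dvd ?q" using 1 by simp
      then have "p dvd (q - ?q) * r"
        using less.prems by (metis dvd_diff dvd_mult2 left_diff_distrib)
      moreover have "q - ?q \<in> C'"
        using lower less.prems C'_diff by blast
      ultimately have "p dvd q - ?q \<or> p dvd r"
        using lower(2)[OF less.prems(1)] less.hyps[of "q - ?q" r] less.prems by auto
      then show ?thesis using \<open>p dvd ?q\<close> by (metis dvd_add diff_add_cancel)
    next
      case 2
      let ?r = "?b * x ^ degree (split r)"
      have "p dvd ?r" using 2 by simp
      then have "p dvd q * (r - ?r)"
        using less.prems by (metis dvd_diff dvd_mult right_diff_distrib)
      moreover have "r - ?r \<in> C'"
        using lower less.prems C'_diff by blast
      ultimately have "p dvd q \<or> p dvd r - ?r"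
        using lower(2)[OF less.prems(2)] less.hyps[of q "r - ?r"] less.prems by auto
      then show ?thesis using \<open>p dvd ?r\<close> by (metis dvd_add diff_add_cancel)
    qed
  qed auto
qed

text \<open>Leading coefficients need not be invertible, so each division step first multiplies by
  that of \<open>u\<close>; \<open>a\<close> collects these factors. A zero remainder is listed
  separately because \<open>u\<close> may have degree 0.\<close>

lemma pseudo_division:
  assumes "p \<in> C'" "u \<in> C'" "u \<noteq> 0"
  obtains a s where "a \<in> C" "a \<noteq> 0" "s \<in> C'"
    "a * p = s * u \<or> degree (split (a * p - s * u)) < degree (split u)"
  using assms(1)
proof (induction "degree (split p)" arbitrary: p thesis rule: less_induct)
  case less
  show ?case
  proof (cases "p = 0 \<or> degree (split p) < degree (split u)")
    case True
    then show ?thesis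
      using less.prems(1)[of 1 0] zero_in one_in C_subset by auto
  next
    case False
    let ?n = "degree (split p)" and ?m = "degree (split u)"
    let ?a = "lead_coeff (split u)" and ?b = "lead_coeff (split p)"
    let ?s = "?b * x ^ (?n - ?m)"
    let ?r = "?a * p - ?s * u"
    have in_C: "?a \<in> C" "?b \<in> C"
      using less.prems assms by (simp_all add: lead_coeff_split)
    have in_C': "?s \<in> C'" "?a \<in> C'"
      using in_C C_subset x_power_in C'_mult by blast+
    have r: "?r \<in> C'"
      by (rule C'_diff[OF C'_mult[OF in_C'(2) less.prems(2)] C'_mult[OF in_C'(1) assms(2)]])
    have split_r: "split ?r = smult ?a (split p) - monom ?b (?n - ?m) * split u"
      unfolding split_diff split_mult[of _ u] split_mult[of ?a p] split_monom[OF in_C(2)] split_const[OF in_C(1)]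
      by simp
    have deg: "degree (monom ?b (?n - ?m) * split u) = ?n"
      using False assms by (simp add: degree_mult_eq degree_monom_eq monom_eq_0_iff)
    have "coeff (split ?r) ?n = 0"
      using False by (simp add: split_r coeff_monom_mult)
    moreover have "degree (split ?r) \<le> ?n"
      unfolding split_r using deg by (intro degree_diff_le) (simp_all add: degree_smult_le)
    ultimately have "?r = 0 \<or> degree (split ?r) < ?n"
      using degree_less_if_coeff_eq_0[of "split ?r"] by simp
    then show ?thesis
    proof
      assume "?r = 0"
      then show ?thesis
        using less.prems(1)[of ?a ?s] in_C in_C' assms by simp
    next
      assume "degree (split ?r) < ?n"
      from less.hyps[OF this _ r] obtain a s where as: "a \<in> C" "a \<noteq> 0" "s \<in> C'"
        "a * ?r = s * u \<or> degree (split (a * ?r - s * u)) < ?m"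
        by blast
      have eq: "a * ?r - s * u = (a * ?a) * p - (a * ?s + s) * u"
        by (simp add: algebra_simps)
      have "a * ?s + s \<in> C'" "a * ?a \<in> C'"
        using as(1,3) in_C' C_subset C'_mult C'_add by blast+
      \<comment> \<open>Closure of \<open>C\<close> under products comes from the degree:
        \<open>a * ?a\<close> is an element of \<open>C'\<close> of degree 0.\<close>
      moreover have "a * ?a \<in> C"
        using calculation(2) as(1) in_C by (intro in_C_if_degree_split) (simp_all add: split_mult split_const)
      ultimately show ?thesis
        using less.prems(1)[of "a * ?a" "a * ?s + s"] as(2,4) assms(3) eq
        by (metis eq_iff_diff_eq_0 leading_coeff_0_iff mult_eq_0_iff split_eq_0_iff)
    qed
  qed
qed

section \<open>Irreducible elements that involve the new variable\<close>

context
  fixes f :: 'a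
  assumes f_irreducible: "irreducible f" and f_in: "f \<in> C'" and f_notin: "f \<notin> C"
begin

lemma f_nonzero: "f \<noteq> 0"
  using f_irreducible by auto

text \<open>Otherwise \<open>f\<close> would be \<open>p\<close> times a unit; units lie in
  \<open>C\<close>, so \<open>f\<close> would have degree 0 and lie in \<open>C\<close>.\<close>

lemma irreducible_in_C_not_dvd:
  assumes "irreducible p" "p \<in> C"
  shows "\<not> p dvd f"
proof
  assume "p dvd f"
  then obtain c where c: "f = p * c" by auto
  then have "c dvd 1"
    using f_irreducible assms(1) by (auto simp: irreducible_def)
  then have "c \<in> C"
    using one_in C_multD by (metis dvdE one_neq_zero)
  with c assms(2) f_in f_notin show False
    by (metis add_0 degree_split_const degree_split_mult in_C_if_degree_split mult_eq_0_iff zero_in)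
qed

text \<open>Factors from \<open>C\<close> are cancelled one irreducible at a time: such a
  \<open>p\<close> does not divide \<open>f\<close>, so by \<open>C_prime_adjoined\<close> it
  divides the cofactor \<open>w\<close>.\<close>

lemma dvd_if_dvd_C_mult:
  assumes "a \<in> C" "a \<noteq> 0" "h \<in> C'" "f dvd a * h"
  shows "f dvd h"
  using assms
proof (induction rule: factor_induct)
  case (unit a)
  then show ?case
    by (blast intro: dvd_if_dvd_unit_mult)
next
  case (step p a)
  show ?case
  proof (cases "h = 0")
    case False
    obtain w where w: "p * a * h = f * w"
      using step.prems by auto
    then have "w \<in> C'"
      using False step C_subset C'_mult C'_multD[of w f] by (metis irreducible_def mult.commute mult_eq_0_iff subsetD)
    moreover have "p dvd f * w"
      using w by (metis dvd_triv_left mult.assoc)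
    ultimately have "p dvd w"
      using C_prime_adjoined step.hyps f_in irreducible_in_C_not_dvd by blast
    then obtain v where "w = p * v" by auto
    with w have "p * (a * h) = p * (f * v)"
      by (simp add: mult_ac)
    then have "a * h = f * v"
      using step.hyps by auto
    with step show ?thesis by auto
  qed auto
qed

text \<open>Each irreducible factor of \<open>a\<close> divides \<open>q\<close> or \<open>u\<close>
  and is divided out there; \<open>b\<close> collects those taken from \<open>u\<close>. A
  factorization of \<open>a * f\<close> thus descends to one of \<open>f\<close>.\<close>

lemma C_mult_eq_multE:
  fixes a q u :: 'a
  assumes "a \<in> C" "a \<noteq> 0" "q \<in> C'" "u \<in> C'" "a * f = q * u"
  shows "\<exists>b q' u'. b \<in> C \<and> b \<noteq> 0 \<and> f = q' * u' \<and> u = b * u'"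
  using assms
proof (induction arbitrary: q u rule: factor_induct)
  case (unit a)
  then obtain a' where "1 = a * a'" by auto
  then have "f = (a' * q) * u"
    using unit by (metis mult.assoc mult.commute mult.left_neutral)
  then show ?case
    using one_in by (intro exI[of _ 1] exI[of _ "a' * q"] exI[of _ u]) simp
next
  case (step p a)
  have nz: "q * u \<noteq> 0"
    using step f_nonzero by (metis irreducible_def mult_eq_0_iff)
  have "p dvd q * u"
    using step.prems by (metis dvd_triv_left mult.assoc)
  then consider "p dvd q" | "p dvd u"
    using C_prime_adjoined step by blast
  then show ?case
  proof cases
    case 1
    then obtain q1 where q1: "q = p * q1" by auto
    then have "q1 \<in> C'"
      using step.prems nz C'_multD[of q1 p] by (auto simp: mult.commute)
    moreover have "a * f = q1 * u"
      using step q1 by (auto simp: mult.assoc)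
    ultimately show ?thesis
      using step by blast
  next
    case 2
    then obtain u1 where u1: "u = p * u1" by auto
    then have "u1 \<in> C'"
      using step.prems nz C'_multD[of u1 p] by (auto simp: mult.commute)
    moreover have "a * f = q * u1"
      using step u1 by (auto simp: mult_ac)
    ultimately obtain b q' u' where "b \<in> C" "b \<noteq> 0" "f = q' * u'" "u1 = b * u'"
      using step by blast
    moreover from this have "p * b \<in> C"
      using step.hyps C_subset C'_mult
      by (intro in_C_if_degree_split) (auto simp: split_mult split_const)
    ultimately show ?thesis
      using u1 step.hyps by (intro exI[of _ "p * b"] exI[of _ q'] exI[of _ u']) (auto simp: mult.assoc)
  qed
qed

text \<open>
  The ideal of all \<open>u\<close> with \<open>f dvd u * h\<close> contains \<open>f\<close> and \<open>g\<close>. A nonzero element \<open>u\<close> of it whose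
  degree in \<open>x\<close> is minimal divides \<open>f\<close> and \<open>g\<close> up to factors from \<open>C\<close>, by pseudo-division.
\<close>

lemma adjoined_prime:
  assumes "g \<in> C'" "h \<in> C'" "f dvd g * h"
  shows "f dvd g \<or> f dvd h"
proof -
  let ?J = "\<lambda>u. u \<in> C' \<and> u \<noteq> 0 \<and> f dvd u * h"
  define u where "u = (ARG_MIN (\<lambda>u. degree (split u)) u. ?J u)"
  have "?J f"
    using f_in f_nonzero by simp
  then have u: "?J u"
    unfolding u_def by (rule arg_min_natI)
  have u_min: "degree (split u) \<le> degree (split v)" if "?J v" for v
    unfolding u_def using that by (rule arg_min_nat_le)
  have division: "\<exists>a q. a \<in> C \<and> a \<noteq> 0 \<and> q \<in> C' \<and> a * p = q * u" if p: "p \<in> C'" "f dvd p * h" for p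
  proof -
    obtain a s where as: "a \<in> C" "a \<noteq> 0" "s \<in> C'"
      "a * p = s * u \<or> degree (split (a * p - s * u)) < degree (split u)"
      using pseudo_division[OF p(1)] u by metis
    have "a * p - s * u \<in> C'"
      using as p(1) u C_subset by (auto intro!: C'_diff C'_mult)
    moreover have "f dvd (a * p - s * u) * h"
      using p(2) u by (simp add: left_diff_distrib mult.assoc)
    \<comment> \<open>A nonzero remainder would satisfy \<open>?J\<close> with smaller degree than
      \<open>u\<close>.\<close>
    ultimately have "a * p - s * u = 0"
      using as(4) u_min[of "a * p - s * u"] by fastforce
    with as show ?thesis by auto
  qed
  \<comment> \<open>Applied to \<open>f\<close> itself, division yields a factorization of
    \<open>f\<close>; irreducibility leaves two cases.\<close>
  from division[of f] f_in obtain a q where aq: "a \<in> C" "a \<noteq> 0" "q \<in> C'" "a * f = q * u"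
    by auto
  with C_mult_eq_multE u obtain b q' u' where b: "b \<in> C" "b \<noteq> 0" "f = q' * u'" "u = b * u'"
    by meson
  consider "u' dvd 1" | "q' dvd 1"
    using irreducibleD[OF f_irreducible b(3)] by blast
  then show ?thesis
  proof cases
    \<comment> \<open>Here \<open>u\<close> is an element of \<open>C\<close> up to a unit, so
      \<open>f\<close> divides \<open>b * h\<close>.\<close>
    case 1
    then obtain v where "1 = u' * v" by auto
    then have "b * h = v * (u * h)"
      using b(4) by (metis mult.assoc mult.commute mult.left_neutral)
    then have "f dvd b * h"
      using u by (metis dvd_mult)
    then show ?thesis
      using b assms(2) dvd_if_dvd_C_mult by blast
  next
    \<comment> \<open>Here \<open>f\<close> divides \<open>u\<close>, and \<open>u\<close> divides
      \<open>g\<close> up to a factor from \<open>C\<close>, because \<open>g\<close> lies in the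
      ideal.\<close>
    case 2
    then obtain v where "1 = q' * v" by auto
    then have "u' = f * v"
      using b(3) by (metis mult.assoc mult.commute mult.left_neutral)
    then have "f dvd u"
      using b(4) by simp
    moreover obtain a' s where "a' \<in> C" "a' \<noteq> 0" "a' * g = s * u"
      using division assms by blast
    ultimately have "f dvd a' * g" by simp
    then show ?thesis
      using \<open>a' \<in> C\<close> \<open>a' \<noteq> 0\<close> assms(1) dvd_if_dvd_C_mult by blast
  qed
qed

end

end

subsection \<open>Irreducible polynomials are prime\<close>

theorem irreducible_imp_prime_polys_in:
  fixes f g h :: "('v::linorder, 'k::field) mpoly"
  assumes "finite S" "irreducible f" "f \<in> polys_in S" "g \<in> polys_in S" "h \<in> polys_in S" "f dvd g * h"
  shows "f dvd g \<or> f dvd h"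
  using assms
proof (induction S arbitrary: f g h rule: finite_induct)
  case empty
  then show ?case
    using polys_in_empty_dvd_1[of f] by (auto simp: irreducible_def)
next
  case (insert x S)
  \<comment> \<open>The size is the total degree; nonzero elements of total degree 0 are constants,
    hence units.\<close>
  interpret adjoined_variable "polys_in S :: ('v, 'k) mpoly set" "polys_in (insert x S)" "split_var x" "var x"
    "\<lambda>p. degree (weight_poly UNIV p)"
  proof
    show "polys_in S \<subseteq> (polys_in (insert x S) :: ('v, 'k) mpoly set)"
      by (intro polys_in_mono) auto
    show "(var x :: ('v, 'k) mpoly) \<in> polys_in (insert x S)"
      by (simp add: var_def)
    show "(1 :: ('v, 'k) mpoly) \<in> polys_in S"
      using polys_in_single[of 0 S 1] by simp
    show "p dvd 1" if "p \<noteq> 0" "degree (weight_poly UNIV p) = 0" for p :: "('v, 'k) mpoly"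
      using that polys_in_iff_degree[of p "{}"] by (simp add: polys_in_empty_dvd_1)
    show "degree (weight_poly UNIV (p * q)) = degree (weight_poly UNIV p) + degree (weight_poly UNIV q)"
      if "p \<noteq> 0" "q \<noteq> 0" for p q :: "('v, 'k) mpoly"
      using that by (metis degree_mult_eq poly_0 poly_weight_poly_1 weight_poly.hom_mult)
    show "p dvd q \<or> p dvd r" if "p \<in> polys_in S" "q \<in> polys_in S" "r \<in> polys_in S" "irreducible p" "p dvd q * r"
      for p q r :: "('v, 'k) mpoly"
      using insert.IH that by blast
  qed (use insert.hyps in \<open>auto simp: polys_in_diff polys_in_mult split_var.hom_diff split_var.hom_mult
        split_var_var split_var_const coeff_split_var_in elim: polys_in_multD\<close>)
  \<comment> \<open>If \<open>f\<close> does not involve \<open>x\<close>, primality passes up from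
    the smaller ring; otherwise the descent of \<open>adjoined_prime\<close> applies.\<close>
  show ?case
    using C_prime_adjoined adjoined_prime insert.prems by (cases "f \<in> polys_in S") blast+
qed

subsection \<open>Renaming the variables\<close>

text \<open>
  The library's integral domain instance for finitely supported functions requires linearly ordered
  exponent vectors; over a finite type of variables the properties are obtained by renaming the
  variables to natural numbers.
\<close>

definition rename_exponents :: "('v \<Rightarrow> 'w) \<Rightarrow> ('v::finite \<Rightarrow>\<^sub>0 nat) \<Rightarrow> ('w \<Rightarrow>\<^sub>0 nat)"
  where "rename_exponents e t = (\<Sum>i\<in>UNIV. Poly_Mapping.single (e i) (Poly_Mapping.lookup t i))"

definition rename_vars :: "('v \<Rightarrow> 'w) \<Rightarrow> ('v::finite, 'k::field) mpoly \<Rightarrow> ('w, 'k) mpoly"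
  where "rename_vars e = monoid_algebra_extend (Poly_Mapping.single 0)
    (\<lambda>t. Poly_Mapping.single (rename_exponents e t) 1)"

interpretation rename_vars: monoid_algebra_hom
    "Poly_Mapping.single 0 :: 'k::field \<Rightarrow> ('w, 'k) mpoly"
    "\<lambda>t. Poly_Mapping.single (rename_exponents e t) 1"
  rewrites "monoid_algebra_extend (Poly_Mapping.single 0)
    (\<lambda>t. Poly_Mapping.single (rename_exponents e t) 1) = rename_vars e"
  for e :: "'v::finite \<Rightarrow> 'w"
  by unfold_locales
     (simp_all add: single_add mult_single rename_exponents_def lookup_add sum.distrib rename_vars_def)

context
  fixes e :: "'v::finite \<Rightarrow> 'w"
  assumes inj: "inj e"
begin

lemma lookup_rename_exponents: "Poly_Mapping.lookup (rename_exponents e t) (e i) = Poly_Mapping.lookup t i"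
  by (simp add: rename_exponents_def lookup_sum lookup_single when_def inj_eq[OF inj])

lemma rename_exponents_eq_iff: "rename_exponents e s = rename_exponents e t \<longleftrightarrow> s = t"
  by (metis lookup_rename_exponents poly_mapping_eqI)

lemma keys_rename_exponents: "Poly_Mapping.keys (rename_exponents e t) \<subseteq> range e"
  unfolding rename_exponents_def by (rule order.trans[OF keys_sum]) (auto split: if_splits)

lemma rename_exponents_map_key:
  assumes "Poly_Mapping.keys s \<subseteq> range e"
  shows "rename_exponents e (Poly_Mapping.map_key e s) = s"
proof (rule poly_mapping_eqI)
  fix j
  show "Poly_Mapping.lookup (rename_exponents e (Poly_Mapping.map_key e s)) j = Poly_Mapping.lookup s j"
  proof (cases "j \<in> range e")
    case True
    then show ?thesis
      by (auto simp: lookup_rename_exponents map_key.rep_eq inj)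
  next
    case False
    then show ?thesis
      using assms keys_rename_exponents by (metis in_keys_iff subsetD)
  qed
qed

lemma rename_vars_in: "rename_vars e p \<in> polys_in (range e)"
  unfolding rename_vars_def monoid_algebra_extend_def
  by (rule polys_in_sum) (simp add: mult_single keys_rename_exponents)

lemma lookup_rename_vars:
  "Poly_Mapping.lookup (rename_vars e p) (rename_exponents e t) = Poly_Mapping.lookup p t"
  by (simp add: rename_vars_def monoid_algebra_extend_def mult_single lookup_sum lookup_single when_def
      rename_exponents_eq_iff in_keys_iff)

lemma rename_vars_eq_iff [simp]: "rename_vars e p = rename_vars e q \<longleftrightarrow> p = q"
  by (metis lookup_rename_vars poly_mapping_eqI)

lemma rename_vars_eq_0_iff [simp]: "rename_vars e p = 0 \<longleftrightarrow> p = 0"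
  using rename_vars_eq_iff[of p 0] by simp

lemma rename_vars_surj:
  assumes "q \<in> polys_in (range e)"
  obtains p where "q = rename_vars e p"
proof
  have "rename_vars e (\<Sum>s\<in>Poly_Mapping.keys q.
      Poly_Mapping.single (Poly_Mapping.map_key e s) (Poly_Mapping.lookup q s)) =
    (\<Sum>s\<in>Poly_Mapping.keys q. Poly_Mapping.single s (Poly_Mapping.lookup q s))"
    unfolding rename_vars.hom_sum using assms
    by (intro sum.cong) (auto simp: polys_in_def mult_single rename_exponents_map_key)
  then show "q = rename_vars e (\<Sum>s\<in>Poly_Mapping.keys q.
      Poly_Mapping.single (Poly_Mapping.map_key e s) (Poly_Mapping.lookup q s))"
    by (simp flip: poly_mapping_eq_sum_single)
qed

end

context
  fixes e :: "'v::finite \<Rightarrow> 'w::linorder"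
  assumes inj: "inj e"
begin

text \<open>The cofactor \<open>r\<close> might a priori involve variables outside
  \<open>range e\<close>; closure under divisors excludes this, so \<open>r\<close> has a
  preimage.\<close>

lemma rename_vars_dvd_iff:
  fixes p q :: "('v, 'k::field) mpoly"
  shows "rename_vars e p dvd rename_vars e q \<longleftrightarrow> p dvd q"
proof
  assume "rename_vars e p dvd rename_vars e q"
  then obtain r where r: "rename_vars e q = r * rename_vars e p"
    by (metis dvdE mult.commute)
  show "p dvd q"
  proof (cases "q = 0")
    case False
    then have "r \<in> polys_in (range e)"
      using rename_vars_in[OF inj, of q] rename_vars_eq_0_iff[OF inj, of q] unfolding r
      by (intro polys_in_multD[of r "rename_vars e p"]) simp_all
    then obtain s where "r = rename_vars e s"
      using rename_vars_surj[OF inj] by blast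
    with r have "q = s * p"
      by (simp add: inj flip: rename_vars.hom_mult)
    then show ?thesis by simp
  qed simp
qed (auto simp: rename_vars.hom_mult)

lemma irreducible_rename_vars:
  fixes p :: "('v, 'k::field) mpoly"
  assumes "irreducible p"
  shows "irreducible (rename_vars e p)"
proof (rule irreducibleI)
  show "rename_vars e p \<noteq> 0"
    using assms inj by auto
  show "\<not> rename_vars e p dvd 1"
    using assms rename_vars_dvd_iff[of p 1] by (auto simp: irreducible_def)
next
  fix a b assume ab: "rename_vars e p = a * b"
  have nz: "a * b \<noteq> 0"
    using assms inj by (auto simp flip: ab)
  have "a * b \<in> polys_in (range e)"
    using rename_vars_in[OF inj, of p] by (simp add: ab)
  then have "a \<in> polys_in (range e)" "b \<in> polys_in (range e)"
    using nz polys_in_multD by (metis mult.commute)+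
  then obtain a' b' where a': "a = rename_vars e a'" and b': "b = rename_vars e b'"
    using rename_vars_surj[OF inj] by metis
  with ab have "p = a' * b'"
    by (simp add: inj flip: rename_vars.hom_mult)
  with assms have "a' dvd 1 \<or> b' dvd 1"
    by (rule irreducibleD)
  then show "a dvd 1 \<or> b dvd 1"
    using rename_vars_dvd_iff[of a' 1] rename_vars_dvd_iff[of b' 1] by (simp add: a' b')
qed

end

lemma exists_inj_nat: "\<exists>e :: 'v::finite \<Rightarrow> nat. inj e"
  using finite_imp_inj_to_nat_seg[of "UNIV :: 'v set"] by auto

section \<open>Domain properties over finitely many variables\<close>

lemma mpoly_mult_eq_0_iff:
  fixes p q :: "('v::finite, 'k::field) mpoly"
  shows "p * q = 0 \<longleftrightarrow> p = 0 \<or> q = 0"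
proof -
  obtain e :: "'v \<Rightarrow> nat" where e: "inj e"
    using exists_inj_nat by blast
  have "p * q = 0 \<longleftrightarrow> rename_vars e p * rename_vars e q = 0"
    using rename_vars_eq_0_iff[OF e, of "p * q"] by (simp add: rename_vars.hom_mult)
  then show ?thesis
    by (simp add: rename_vars_eq_0_iff[OF e])
qed

lemma mpoly_mult_right_cancel:
  fixes p q r :: "('v::finite, 'k::field) mpoly"
  assumes "r \<noteq> 0"
  shows "p * r = q * r \<longleftrightarrow> p = q"
  using mpoly_mult_eq_0_iff[of "p - q" r] assms by (simp add: left_diff_distrib)

lemma mpoly_power_eq_0D: "(p :: ('v::finite, 'k::field) mpoly) ^ n = 0 \<Longrightarrow> p = 0"
  by (induction n) (auto simp: mpoly_mult_eq_0_iff)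

lemma mpoly_prod_eq_0_iff:
  fixes g :: "'i \<Rightarrow> ('v::finite, 'k::field) mpoly"
  shows "finite I \<Longrightarrow> prod g I = 0 \<longleftrightarrow> (\<exists>i\<in>I. g i = 0)"
  by (induction I rule: finite_induct) (auto simp: mpoly_mult_eq_0_iff)

theorem mpoly_irreducible_imp_prime_elem:
  fixes p :: "('v::finite, 'k::field) mpoly"
  assumes "irreducible p"
  shows "prime_elem p"
proof (rule prime_elemI)
  obtain e :: "'v \<Rightarrow> nat" where e: "inj e"
    using exists_inj_nat by blast
  fix a b assume "p dvd a * b"
  then have "rename_vars e p dvd rename_vars e a * rename_vars e b"
    by (simp add: rename_vars_dvd_iff[OF e] flip: rename_vars.hom_mult)
  with irreducible_rename_vars[OF e assms] have "rename_vars e p dvd rename_vars e a \<or> rename_vars e p dvd rename_vars e b"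
    by (intro irreducible_imp_prime_polys_in[of "range e"]) (simp_all add: rename_vars_in[OF e])
  then show "p dvd a \<or> p dvd b"
    by (simp add: rename_vars_dvd_iff[OF e])
qed (use assms in \<open>auto simp: irreducible_def\<close>)

subsection \<open>Homogeneous polynomials\<close>

lemma homogeneous_polys_mult:
  "p \<in> homogeneous_polys a \<Longrightarrow> q \<in> homogeneous_polys b \<Longrightarrow> p * q \<in> homogeneous_polys (a + b)"
  by (simp add: homogeneous_polys_iff_weight_poly weight_poly.hom_mult mult_monom)

lemma one_homogeneous: "1 \<in> homogeneous_polys 0"
  by (simp add: homogeneous_polys_def)

lemma homogeneous_polys_prod:
  assumes "finite I" "\<And>i. i \<in> I \<Longrightarrow> g i \<in> homogeneous_polys k"
  shows "prod g I \<in> homogeneous_polys (card I * k)"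
  using assms
  by (induction I rule: finite_induct) (simp_all add: one_homogeneous homogeneous_polys_mult)

lemma subspace_homogeneous_polys: "mpoly.subspace (homogeneous_polys m)"
proof (rule mpoly.subspaceI)
  show "mscale c p \<in> homogeneous_polys m" if "p \<in> homogeneous_polys m" for c p
    using that by (auto simp: homogeneous_polys_def in_keys_iff lookup_mscale)
qed (auto simp: homogeneous_polys_iff_weight_poly weight_poly.hom_add add_monom)

lemma homogeneous_0_dvd_1:
  assumes "p \<in> homogeneous_polys 0" "p \<noteq> 0"
  shows "p dvd 1"
proof -
  have "p \<in> polys_in {}"
    using assms(1) by (simp add: homogeneous_polys_iff_weight_poly polys_in_iff_weight_poly)
  then show ?thesis
    using assms(2) by (rule polys_in_empty_dvd_1)
qed

text \<open>Multiplication by \<open>y\<close> shifts the homogeneous components of \<open>p\<close>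
  by \<open>k\<close>. Comparing components and cancelling \<open>y\<close> gives the degree of
  \<open>p\<close>; for \<open>d < k\<close> nothing can land in degree \<open>d\<close>.\<close>

lemma homogeneous_multD:
  fixes p y :: "('v::finite, 'k::field) mpoly"
  assumes "p * y \<in> homogeneous_polys d" "y \<in> homogeneous_polys k" "y \<noteq> 0"
  shows "k \<le> d \<Longrightarrow> p \<in> homogeneous_polys (d - k)"
    and "d < k \<Longrightarrow> p * y = 0"
proof -
  have eq: "monom y k * weight_poly UNIV p = monom (p * y) d"
    using assms by (simp add: homogeneous_polys_iff_weight_poly weight_poly.hom_mult mult.commute)
  show "p \<in> homogeneous_polys (d - k)" if "k \<le> d"
    unfolding homogeneous_polys_iff_weight_poly
  proof (rule poly_eqI)
    fix j
    have "coeff (weight_poly UNIV p) j * y = coeff (monom p (d - k)) j * y"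
      using arg_cong[OF eq, of "\<lambda>P. coeff P (k + j)"] that
      unfolding coeff_monom_mult coeff_monom by (auto simp: mult.commute)
    then show "coeff (weight_poly UNIV p) j = coeff (monom p (d - k)) j"
      using mpoly_mult_right_cancel[OF assms(3)] by blast
  qed
  show "p * y = 0" if "d < k"
    using arg_cong[OF eq, of "\<lambda>P. coeff P d"] that by (simp add: coeff_monom_mult)
qed

section \<open>Finite dimension and nonvanishing of the homogeneous parts\<close>

lemma finite_exponents: "finite {t :: 'v::finite \<Rightarrow>\<^sub>0 nat. (\<Sum>i\<in>UNIV. Poly_Mapping.lookup t i) = m}"
proof (rule inj_on_finite)
  let ?T = "{t :: 'v \<Rightarrow>\<^sub>0 nat. (\<Sum>i\<in>UNIV. Poly_Mapping.lookup t i) = m}"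
  show "inj_on Poly_Mapping.lookup ?T"
    by (simp add: inj_on_def poly_mapping.lookup_inject)
  show "Poly_Mapping.lookup ` ?T \<subseteq> {f. \<forall>i. (i \<in> UNIV \<longrightarrow> f i \<in> {..m}) \<and> (i \<notin> UNIV \<longrightarrow> f i = 0)}"
    by (auto intro!: member_le_sum)
  show "finite {f :: 'v \<Rightarrow> nat. \<forall>i. (i \<in> UNIV \<longrightarrow> f i \<in> {..m}) \<and> (i \<notin> UNIV \<longrightarrow> f i = 0)}"
    by (rule finite_set_of_finite_funs) auto
qed

lemma homogeneous_polys_finite_dim:
  "\<exists>B. finite B \<and> (homogeneous_polys m :: ('v::finite, 'k::field) mpoly set) \<subseteq> mpoly.span B"
proof (intro exI conjI)
  let ?T = "{t :: 'v \<Rightarrow>\<^sub>0 nat. (\<Sum>i\<in>UNIV. Poly_Mapping.lookup t i) = m}"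
  let ?B = "(\<lambda>t. Poly_Mapping.single t (1::'k)) ` ?T"
  show "finite ?B"
    by (simp add: finite_exponents)
  show "homogeneous_polys m \<subseteq> mpoly.span ?B"
  proof
    fix p :: "('v, 'k) mpoly" assume p: "p \<in> homogeneous_polys m"
    have "(\<Sum>t\<in>Poly_Mapping.keys p. mscale (Poly_Mapping.lookup p t) (Poly_Mapping.single t 1)) \<in> mpoly.span ?B"
      using p by (intro mpoly.span_sum mpoly.span_scale mpoly.span_base) (auto simp: homogeneous_polys_def)
    then show "p \<in> mpoly.span ?B"
      by (simp add: mscale_def mult_single flip: poly_mapping_eq_sum_single)
  qed
qed

lemma dim_homogeneous_polys_pos: "mpoly.dim (homogeneous_polys m :: ('v::finite, 'k::field) mpoly set) > 0"
proof (rule ccontr)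
  let ?A = "homogeneous_polys m :: ('v, 'k) mpoly set"
  assume dim: "\<not> mpoly.dim ?A > 0"
  obtain B where B: "B \<subseteq> ?A" "mpoly.independent B" "?A \<subseteq> mpoly.span B" "card B = mpoly.dim ?A"
    using mpoly.basis_exists by blast
  obtain F where "finite F" "?A \<subseteq> mpoly.span F"
    using homogeneous_polys_finite_dim by blast
  \<comment> \<open>\<open>card B = 0\<close> alone would also allow an infinite basis; the finite
    spanning set rules this out.\<close>
  then have "finite B"
    using B mpoly.independent_span_bound by blast
  then have "?A \<subseteq> {0}"
    using B dim by simp
  \<comment> \<open>The \<open>m\<close>-th power of an arbitrary variable is a nonzero
    element.\<close>
  moreover have "Poly_Mapping.single (Poly_Mapping.single undefined m) 1 \<in> ?A"
    by (simp add: homogeneous_polys_def lookup_single when_def)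
  ultimately show False
    by (metis lookup_single_eq lookup_zero one_neq_zero singletonD subsetD)
qed

subsection \<open>The spaces of multiples\<close>

lemma mpoly_linear_mult_right: "Vector_Spaces.linear mscale mscale (\<lambda>g :: ('v, 'k::field) mpoly. g * y)"
  by unfold_locales (simp_all add: mscale_def distrib_right mult.assoc)

text \<open>Multiplication by \<open>y\<close> is linear and injective, so it carries a basis of
  \<open>homogeneous_polys m\<close> to a basis of the multiples.\<close>

lemma subspace_of_dim_multiples_space:
  fixes y :: "('v::finite, 'k::field) mpoly"
  assumes "y \<noteq> 0"
  shows "mpoly.subspace_of_dim (multiples_space m y) (mpoly.dim (homogeneous_polys m :: ('v, 'k) mpoly set))"
proof -
  interpret vector_space_pair "mscale :: 'k \<Rightarrow> ('v, 'k) mpoly \<Rightarrow> _" "mscale :: 'k \<Rightarrow> ('v, 'k) mpoly \<Rightarrow> _" ..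
  let ?A = "homogeneous_polys m :: ('v, 'k) mpoly set" and ?f = "\<lambda>g. g * y"
  note lin = mpoly_linear_mult_right[of y]
  have W: "multiples_space m y = ?f ` ?A"
    by (auto simp: multiples_space_def)
  obtain B where B: "B \<subseteq> ?A" "mpoly.independent B" "?A \<subseteq> mpoly.span B" "card B = mpoly.dim ?A"
    using mpoly.basis_exists by blast
  have "inj ?f"
    using mpoly_mult_right_cancel[OF assms] by (auto simp: inj_def)
  then have "mpoly.independent (?f ` B)" "card (?f ` B) = card B"
    using linear_independent_injective_image[OF lin B(2)] by (auto intro: card_image inj_on_subset)
  moreover have "mpoly.span B = ?A"
    using B mpoly.span_minimal subspace_homogeneous_polys by blast
  then have "mpoly.span (?f ` B) = mpoly.span (?f ` ?A)"
    unfolding linear_span_image[OF lin] using mpoly.span_eq_iff subspace_homogeneous_polys by metis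
  ultimately have "mpoly.dim (?f ` ?A) = mpoly.dim ?A"
    using mpoly.dim_eq_card B(4) by metis
  moreover have "mpoly.subspace (?f ` ?A)"
    using linear_subspace_image[OF lin] subspace_homogeneous_polys by blast
  moreover obtain F where "finite F" "?A \<subseteq> mpoly.span F"
    using homogeneous_polys_finite_dim by blast
  then have "finite (?f ` F)" "?f ` ?A \<subseteq> mpoly.span (?f ` F)"
    using linear_span_image[OF lin, of F] by auto
  ultimately show ?thesis
    unfolding mpoly.subspace_of_dim_def W by blast
qed

text \<open>This turns intersections of members into sets of common multiples.\<close>

lemma multiples_space_iff:
  fixes y :: "('v::finite, 'k::field) mpoly"
  assumes "y \<in> homogeneous_polys k" "y \<noteq> 0" "k \<le> d"
  shows "h \<in> multiples_space (d - k) y \<longleftrightarrow> h \<in> homogeneous_polys d \<and> y dvd h"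
proof
  assume "h \<in> multiples_space (d - k) y"
  then obtain g where "g \<in> homogeneous_polys (d - k)" "h = g * y"
    by (auto simp: multiples_space_def)
  then show "h \<in> homogeneous_polys d \<and> y dvd h"
    using homogeneous_polys_mult[of g "d - k" y k] assms by simp
next
  assume h: "h \<in> homogeneous_polys d \<and> y dvd h"
  then obtain g where "h = g * y"
    by (metis dvdE mult.commute)
  then show "h \<in> multiples_space (d - k) y"
    using homogeneous_multD(1)[of g y d k] h assms by (auto simp: multiples_space_def)
qed

text \<open>\<open>w\<close> is a unit whose inverse \<open>v\<close> also has degree 0, so either
  can be moved into \<open>g\<close> without changing its degree.\<close>

lemma multiples_space_mult_const:
  fixes w y :: "('v::finite, 'k::field) mpoly"
  assumes "w \<in> homogeneous_polys 0" "w \<noteq> 0"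
  shows "multiples_space m (y * w) = multiples_space m y"
proof -
  obtain v where v: "1 = v * w"
    using homogeneous_0_dvd_1[OF assms] by (metis dvdE mult.commute)
  then have v0: "v \<in> homogeneous_polys 0"
    using homogeneous_multD(1)[of v w 0 0] one_homogeneous assms by simp
  show ?thesis
  proof (intro set_eqI iffI)
    fix h assume "h \<in> multiples_space m (y * w)"
    then obtain g where g: "g \<in> homogeneous_polys m" "h = g * (y * w)"
      by (auto simp: multiples_space_def)
    from g(2) have "h = (g * w) * y"
      by (simp add: mult_ac)
    then show "h \<in> multiples_space m y"
      unfolding multiples_space_def using homogeneous_polys_mult[OF g(1) assms(1)]
      by (intro CollectI exI[of _ "g * w"]) simp
  next
    fix h assume "h \<in> multiples_space m y"
    then obtain g where g: "g \<in> homogeneous_polys m" "h = g * y"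
      by (auto simp: multiples_space_def)
    have "(g * v) * (y * w) = (g * y) * (v * w)"
      by (simp add: mult_ac)
    then have "h = (g * v) * (y * w)"
      by (simp add: g(2) flip: v)
    then show "h \<in> multiples_space m (y * w)"
      unfolding multiples_space_def using homogeneous_polys_mult[OF g(1) v0]
      by (intro CollectI exI[of _ "g * v"]) simp
  qed
qed

lemma multiples_space_eq_if_mult:
  fixes w y z :: "('v::finite, 'k::field) mpoly"
  assumes "y \<in> homogeneous_polys k" "z \<in> homogeneous_polys k" "z \<noteq> 0" "z = y * w"
  shows "multiples_space m z = multiples_space m y"
proof -
  have "y \<noteq> 0" "w \<noteq> 0"
    using assms by auto
  moreover have "w \<in> homogeneous_polys 0"
    using homogeneous_multD(1)[of w y k k] assms \<open>y \<noteq> 0\<close> by (simp add: mult.commute)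
  ultimately show ?thesis
    using multiples_space_mult_const assms(4) by blast
qed

subsection \<open>Powers of irreducible polynomials\<close>

text \<open>\<open>f\<close> and \<open>g\<close> are associates, so one power divides the other,
  and equal degrees make the quotient a nonzero constant. Contrapositively, distinct members come
  from bases that do not divide each other.\<close>

lemma multiples_space_eq_if_irreducible_dvd:
  fixes f g :: "('v::finite, 'k::field) mpoly"
  assumes "irreducible f" "irreducible g" "f dvd g"
    and "f ^ a \<in> homogeneous_polys k" "g ^ b \<in> homogeneous_polys k"
  shows "multiples_space m (f ^ a) = multiples_space m (g ^ b)"
proof -
  obtain u where u: "g = f * u"
    using assms(3) by auto
  then have "u dvd 1"
    using irreducibleD[OF assms(2) u] assms(1) by (auto simp: irreducible_def)
  then obtain v where v: "1 = u * v" by auto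
  have nz: "f ^ a \<noteq> 0" "g ^ b \<noteq> 0"
    using assms(1,2) mpoly_power_eq_0D by (metis irreducible_def)+
  show ?thesis
  proof (cases "a \<le> b")
    case True
    then have "f ^ b = f ^ a * f ^ (b - a)"
      by (simp flip: power_add)
    then have "g ^ b = f ^ a * (f ^ (b - a) * u ^ b)"
      by (simp add: u power_mult_distrib mult.assoc)
    then show ?thesis
      using multiples_space_eq_if_mult assms(4,5) nz by metis
  next
    \<comment> \<open>The quotient is now formed in the other direction; \<open>v ^ b\<close>
      cancels the unit in \<open>g ^ b\<close>.\<close>
    case False
    have "g ^ b * (f ^ (a - b) * v ^ b) = (f ^ b * f ^ (a - b)) * (u * v) ^ b"
      by (simp add: u power_mult_distrib mult_ac)
    also have "\<dots> = f ^ a"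
      using False by (simp flip: v power_add)
    finally show ?thesis
      using multiples_space_eq_if_mult assms(4,5) nz by metis
  qed
qed

lemma prime_elem_power_dvd_cancel:
  fixes f z h :: "('v::finite, 'k::field) mpoly"
  assumes "prime_elem f" "\<not> f dvd z" "f ^ a dvd z * h"
  shows "f ^ a dvd h"
  using assms(3)
proof (induction a arbitrary: h)
  case (Suc a)
  have "f \<noteq> 0"
    using assms(1) by (auto simp: prime_elem_def)
  have "f dvd z * h"
    using Suc.prems by (metis dvd_mult_left power_Suc)
  then obtain h' where h': "h = h' * f"
    using assms(1,2) by (metis dvdE mult.commute prime_elem_dvd_mult_iff)
  obtain w where "z * h = f ^ Suc a * w"
    using Suc.prems by auto
  then have "(z * h') * f = (f ^ a * w) * f"
    by (simp add: h' mult_ac)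
  then have "z * h' = f ^ a * w"
    using mpoly_mult_right_cancel[OF \<open>f \<noteq> 0\<close>] by blast
  then show ?case
    using Suc.IH[of h'] by (simp add: h' mult.commute mult_dvd_mono)
qed simp

lemma prime_elem_dvd_prod:
  fixes p :: "'a::comm_semiring_1"
  shows "finite I \<Longrightarrow> prime_elem p \<Longrightarrow> p dvd prod g I \<Longrightarrow> \<exists>i\<in>I. p dvd g i"
  by (induction I rule: finite_induct) (auto simp: prime_elem_dvd_mult_iff dest: prime_elem_not_unit)

text \<open>A prime that divides none of the other \<open>f j\<close> does not divide the product of
  their powers, so \<open>f i ^ a i\<close> divides the cofactor of that product in
  \<open>h\<close>.\<close>

lemma prod_irreducible_powers_dvd:
  fixes f :: "'i \<Rightarrow> ('v::finite, 'k::field) mpoly"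
  assumes "finite I" "\<And>i. i \<in> I \<Longrightarrow> irreducible (f i)"
    and "\<And>i j. i \<in> I \<Longrightarrow> j \<in> I \<Longrightarrow> i \<noteq> j \<Longrightarrow> \<not> f i dvd f j"
    and "\<And>i. i \<in> I \<Longrightarrow> f i ^ a i dvd h"
  shows "(\<Prod>i\<in>I. f i ^ a i) dvd h"
  using assms
proof (induction I rule: finite_induct)
  case (insert i I)
  let ?z = "\<Prod>j\<in>I. f j ^ a j"
  have prime: "prime_elem (f i)"
    using insert.prems(1) by (simp add: mpoly_irreducible_imp_prime_elem)
  have "?z dvd h"
    using insert by simp
  then obtain w where w: "h = ?z * w" by auto
  have "\<not> f i dvd ?z"
  proof
    assume "f i dvd ?z"
    then obtain j where "j \<in> I" "f i dvd f j ^ a j"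
      using prime_elem_dvd_prod insert.hyps(1) prime by blast
    then show False
      using insert.prems(2)[of i j] insert.hyps prime by (auto dest: prime_elem_dvd_power)
  qed
  moreover have "f i ^ a i dvd ?z * w"
    using insert.prems(3)[of i] unfolding w by simp
  ultimately have "f i ^ a i dvd w"
    by (rule prime_elem_power_dvd_cancel[OF prime])
  then show ?case
    using insert.hyps w by (simp add: mult.commute mult_dvd_mono)
qed simp

text \<open>The generator in the definition only spans the same line as a power
  \<open>f ^ e\<close>; a nonzero scalar turns it into the power without changing the space.\<close>

lemma irreducible_power_familyE:
  fixes W :: "('v::finite, 'k::field) mpoly set"
  assumes "W \<in> irreducible_power_family d k"
  obtains f e where "irreducible f" "f ^ e \<in> homogeneous_polys k" "W = multiples_space (d - k) (f ^ e)"
proof -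
  obtain y :: "('v, 'k) mpoly" and f e where y: "W = multiples_space (d - k) y"
    "mpoly.span {y} = mpoly.span {f ^ e}" "irreducible f" "f ^ e \<in> homogeneous_polys k"
    using assms by (auto simp: irreducible_power_family_def irreducible_power_lines_def)
  have nz: "f ^ e \<noteq> 0"
    using y(3) mpoly_power_eq_0D by (metis irreducible_def)
  have "f ^ e \<in> mpoly.span {y}"
    using y(2) mpoly.span_base by blast
  then obtain c where c: "f ^ e = mscale c y"
    by (auto simp: mpoly.span_singleton)
  then have "c \<noteq> 0"
    using nz by auto
  then have "multiples_space (d - k) (y * Poly_Mapping.single 0 c) = multiples_space (d - k) y"
    by (intro multiples_space_mult_const)
       (auto simp: homogeneous_polys_def dest: arg_cong[of _ _ "\<lambda>p. Poly_Mapping.lookup p 0"])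
  moreover have "y * Poly_Mapping.single 0 c = f ^ e"
    using c by (simp add: mscale_def mult.commute)
  ultimately show thesis
    using that[of f e] y by simp
qed

text \<open>\<open>P\<close> is the product of one generator for each member. Their bases do not
  divide each other, so the common multiples are exactly the multiples of \<open>P\<close>.\<close>

lemma Inter_irreducible_power_family:
  fixes S :: "('v::finite, 'k::field) mpoly set set"
  assumes "S \<subseteq> irreducible_power_family d k" "finite S" "S \<noteq> {}" "k \<le> d"
  obtains P where "P \<noteq> 0" "P \<in> homogeneous_polys (card S * k)"
    "\<Inter>S = {h \<in> homogeneous_polys d. P dvd h}"
proof -
  have "\<forall>W\<in>S. \<exists>f e. irreducible f \<and> f ^ e \<in> homogeneous_polys k \<and> W = multiples_space (d - k) (f ^ e)"
    using assms(1) irreducible_power_familyE by blast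
  then obtain f e where fe: "\<And>W. W \<in> S \<Longrightarrow> irreducible (f W)"
    "\<And>W. W \<in> S \<Longrightarrow> f W ^ e W \<in> homogeneous_polys k"
    "\<And>W. W \<in> S \<Longrightarrow> W = multiples_space (d - k) (f W ^ e W)"
    by metis
  have nz: "f W ^ e W \<noteq> 0" if "W \<in> S" for W
    using fe(1)[OF that] mpoly_power_eq_0D by (metis irreducible_def)
  have mem: "h \<in> W \<longleftrightarrow> h \<in> homogeneous_polys d \<and> f W ^ e W dvd h" if "W \<in> S" for h W
    using multiples_space_iff[OF fe(2) nz assms(4)] fe(3) that by blast
  have not_dvd: "\<not> f W dvd f W'" if "W \<in> S" "W' \<in> S" "W \<noteq> W'" for W W'
    using multiples_space_eq_if_irreducible_dvd[of "f W" "f W'" "e W" k "e W'" "d - k"] fe that by metis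
  let ?P = "\<Prod>W\<in>S. f W ^ e W"
  have "?P \<noteq> 0"
    using assms(2) nz by (simp add: mpoly_prod_eq_0_iff)
  moreover have "?P \<in> homogeneous_polys (card S * k)"
    using assms(2) fe(2) by (rule homogeneous_polys_prod)
  moreover have "\<Inter>S = {h \<in> homogeneous_polys d. ?P dvd h}"
  proof (intro set_eqI iffI)
    fix h assume h: "h \<in> \<Inter>S"
    have "f W ^ e W dvd h" if "W \<in> S" for W
      using h mem that by blast
    then have "?P dvd h"
      using assms(2) fe(1) not_dvd by (intro prod_irreducible_powers_dvd) auto
    then show "h \<in> {h \<in> homogeneous_polys d. ?P dvd h}"
      using h mem assms(3) by blast
  next
    fix h assume h: "h \<in> {h \<in> homogeneous_polys d. ?P dvd h}"
    have "f W ^ e W dvd h" if "W \<in> S" for W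
      using dvd_prodI[OF assms(2) that, of "\<lambda>W. f W ^ e W"] h dvd_trans by blast
    then show "h \<in> \<Inter>S"
      using h mem by blast
  qed
  ultimately show thesis
    using that by blast
qed

section \<open>The dual arc of irreducible powers\<close>

theorem theorem6p3:
  fixes k d c :: nat
    and D :: "('v::finite, 'k::field) mpoly set set"
  assumes "CARD('v) > 1"
    and "k \<ge> 1" and "d \<ge> k"
    and "c > 0" and "0 \<le> int d - int k * int c" and "int d - int k * int c < int k"
    and "D = irreducible_power_family d k"
  shows "mpoly.generalized_dual_arc (homogeneous_polys d :: ('v, 'k) mpoly set)
    (mpoly.dim (homogeneous_polys d :: ('v, 'k) mpoly set)) c
    (\<lambda>j. mpoly.dim (homogeneous_polys (d - j * k) :: ('v, 'k) mpoly set)) D"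
proof -
  let ?dim = "\<lambda>m. mpoly.dim (homogeneous_polys m :: ('v, 'k) mpoly set)"
  have "int (c * k) \<le> int d" "int d < int ((c + 1) * k)"
    using assms(5,6) by (simp_all add: algebra_simps)
  then have c: "c * k \<le> d" "d < (c + 1) * k"
    by linarith+
  \<comment> \<open>Cardinality 1 is included so that the members themselves are covered.\<close>
  have inter: "mpoly.subspace_of_dim (\<Inter>S) (?dim (d - card S * k))" "\<Inter>S \<subseteq> homogeneous_polys d"
    if S: "S \<subseteq> D" "card S \<ge> 1" "card S \<le> c" for S
  proof -
    have "finite S" "S \<noteq> {}"
      using S(2) by (auto intro: card_ge_0_finite)
    then obtain P where P: "P \<noteq> 0" "P \<in> homogeneous_polys (card S * k)"
      "\<Inter>S = {h \<in> homogeneous_polys d. P dvd h}"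
      using Inter_irreducible_power_family[of S d k] S(1) assms(3,7) by blast
    have "card S * k \<le> d"
      using S(3) c(1) by (meson le_trans mult_le_mono1)
    then have "\<Inter>S = multiples_space (d - card S * k) P"
      using P multiples_space_iff[OF P(2,1)] by auto
    then show "mpoly.subspace_of_dim (\<Inter>S) (?dim (d - card S * k))"
      using subspace_of_dim_multiples_space[OF P(1)] by simp
    show "\<Inter>S \<subseteq> homogeneous_polys d"
      using P(3) by auto
  qed
  have "\<Inter>S = {0}" if S: "S \<subseteq> D" "card S = c + 1" for S
  proof -
    have "finite S" "S \<noteq> {}"
      using S(2) by (auto intro: card_ge_0_finite)
    then obtain P where P: "P \<noteq> 0" "P \<in> homogeneous_polys (card S * k)"
      "\<Inter>S = {h \<in> homogeneous_polys d. P dvd h}"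
      using Inter_irreducible_power_family[of S d k] S(1) assms(3,7) by blast
    have "h = 0" if h: "h \<in> homogeneous_polys d" "P dvd h" for h
    proof -
      obtain g where "h = g * P"
        using h(2) by (metis dvdE mult.commute)
      \<comment> \<open>The degree \<open>(c + 1) * k\<close> of \<open>P\<close> exceeds
        \<open>d\<close>, so a multiple of \<open>P\<close> in degree \<open>d\<close> is
        zero.\<close>
      then show ?thesis
        using homogeneous_multD(2)[OF _ P(2,1)] h(1) S(2) c(2) by simp
    qed
    moreover have "0 \<in> homogeneous_polys d"
      by (simp add: homogeneous_polys_def)
    ultimately show ?thesis
      unfolding P(3) by auto
  qed
  moreover have "W \<subseteq> homogeneous_polys d \<and> mpoly.subspace_of_dim W (?dim (d - 1 * k))" if "W \<in> D" for W
    using inter[of "{W}"] that assms(4) by simp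
  moreover have "mpoly.subspace_of_dim (homogeneous_polys d :: ('v, 'k) mpoly set) (?dim d)"
    by (simp add: mpoly.subspace_of_dim_def subspace_homogeneous_polys homogeneous_polys_finite_dim)
  ultimately show ?thesis
    using inter dim_homogeneous_polys_pos by (auto simp: mpoly.generalized_dual_arc_def)
qed

end
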